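(* Fix $n\ge 3$, $j\in[2,n-1]$ and $\pi\in\mathfrak S_n$. The following are equivalent: (a) $\pi$ possesses a reduced word accepted by the automaton $\mathbb U(j)$; (b) $\pi$ avoids the pattern $jki$ with $i<j<k$. Likewise, the following are equivalent: (a') $\pi$ possesses a reduced word accepted by $\mathbb D(j)$; (b') $\pi$ avoids the pattern $kij$ with $i<j<k$.
   Context: $\mathfrak S_n$ is generated by $s_a=(a\ a{+}1)$, $a\in[n-1]$; a word $s_{a_1}\cdots s_{a_\ell}$ represents $\pi=s_{a_1}\circ\cdots\circ s_{a_\ell}$ (composition of maps), written in one-line notation $\pi(1)\pi(2)\cdots\pi(n)$; it is a reduced word for $\pi$ if $\ell$ is minimal. For fixed $j$, $\pi$ avoids $jki$ (resp. $kij$) if there are no $i<j<k$ such that $j,k,i$ (resp. $k,i,j$) appear in this order in $\pi(1)\cdots\pi(n)$. Automata read words left to right over the alphabet $\{s_1,\dots,s_{n-1}\}$; any letter without a specified transition is a loop; a word is accepted iff the run from the initial state never enters a dead state (dead states are absorbing and rejecting; all other states are accepting). $\mathbb U(j)$: states $H_j$ (initial), $H_{j+1},\dots,H_n$, ill states $I_j,\dots,I_{n-1}$ and a dead state; for $m\in[j,n-1]$: from $H_m$, $s_m\to H_{m+1}$ and $s_{m-1}\to I_m$; from $I_m$, $s_m\to$ dead; $H_n$ loops on every letter. $\mathbb D(j)$: states $G_j$ (initial), $G_{j-1},\dots,G_1$, ill states $J_j,\dots,J_2$ and a dead state; for $m\in[2,j]$: from $G_m$, $s_{m-1}\to G_{m-1}$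 and $s_m\to J_m$; from $J_m$, $s_{m-1}\to$ dead; $G_1$ loops on every letter. *)

theory Defs
  imports "HOL-Combinatorics.Combinatorics"
begin

text \<open>
  Elements of the symmetric group \<open>S\<^sub>n\<close> are functions \<open>\<pi>\<close> with \<open>\<pi> permutes {1..n}\<close>.
  The word \<open>s\<^bsub>a1\<^esub> \<dots> s\<^bsub>al\<^esub>\<close> is represented by the list \<open>[a1, \<dots>, al]\<close> of its indices.
\<close>

definition adj_transp :: "nat \<Rightarrow> nat \<Rightarrow> nat" where
  "adj_transp a = transpose a (a + 1)"

definition word_perm :: "nat list \<Rightarrow> nat \<Rightarrow> nat" where
  "word_perm w = foldr (\<lambda>a f. adj_transp a \<circ> f) w id"

definition word_for :: "nat \<Rightarrow> nat list \<Rightarrow> (nat \<Rightarrow> nat) \<Rightarrow> bool" where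
  "word_for n w \<pi> \<longleftrightarrow> w \<in> lists {1..n - 1} \<and> word_perm w = \<pi>"

definition reduced_word_for :: "nat \<Rightarrow> nat list \<Rightarrow> (nat \<Rightarrow> nat) \<Rightarrow> bool" where
  "reduced_word_for n w \<pi> \<longleftrightarrow>
     word_for n w \<pi> \<and> (\<forall>w'. word_for n w' \<pi> \<longrightarrow> length w \<le> length w')"

text \<open>The values \<open>x\<close>, \<open>y\<close>, \<open>z\<close> occur in this order in the one-line notation \<open>\<pi>(1) \<dots> \<pi>(n)\<close>.\<close>

definition appear_in_order :: "nat \<Rightarrow> (nat \<Rightarrow> nat) \<Rightarrow> nat \<Rightarrow> nat \<Rightarrow> nat \<Rightarrow> bool" where
  "appear_in_order n \<pi> x y z \<longleftrightarrow>
     (\<exists>p q r. 1 \<le> p \<and> p < q \<and> q < r \<and> r \<le> n \<and> \<pi> p = x \<and> \<pi> q = y \<and> \<pi> r = z)"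

definition avoids_jki :: "nat \<Rightarrow> nat \<Rightarrow> (nat \<Rightarrow> nat) \<Rightarrow> bool" where
  "avoids_jki n j \<pi> \<longleftrightarrow> \<not> (\<exists>i k. i < j \<and> j < k \<and> appear_in_order n \<pi> j k i)"

definition avoids_kij :: "nat \<Rightarrow> nat \<Rightarrow> (nat \<Rightarrow> nat) \<Rightarrow> bool" where
  "avoids_kij n j \<pi> \<longleftrightarrow> \<not> (\<exists>i k. i < j \<and> j < k \<and> appear_in_order n \<pi> k i j)"

text \<open>
  The states of both automata: \<open>Healthy m\<close> stands for \<open>H\<^sub>m\<close> in \<open>U(j)\<close> and for \<open>G\<^sub>m\<close> in \<open>D(j)\<close>,
  \<open>Ill m\<close> stands for \<open>I\<^sub>m\<close> and \<open>J\<^sub>m\<close>, respectively. The automata have only the states whose index is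
  in the appropriate range; the transition functions below, which read the index \<open>a\<close> of a letter
  \<open>s\<^sub>a\<close>, are extended to all other values of the type by loops. These values are unreachable.
\<close>

datatype state = Healthy nat | Ill nat | Dead

fun U_step :: "nat \<Rightarrow> nat \<Rightarrow> state \<Rightarrow> nat \<Rightarrow> state" where
  "U_step n j (Healthy m) a =
     (if m \<in> {j..n - 1} \<and> a = m then Healthy (m + 1)
      else if m \<in> {j..n - 1} \<and> a + 1 = m then Ill m
      else Healthy m)"
| "U_step n j (Ill m) a = (if m \<in> {j..n - 1} \<and> a = m then Dead else Ill m)"
| "U_step n j Dead a = Dead"

text \<open>The transitions of \<open>D(j)\<close> do not depend on \<open>n\<close>; only its alphabet does.\<close>

fun D_step :: "nat \<Rightarrow> state \<Rightarrow> nat \<Rightarrow> state" where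
  "D_step j (Healthy m) a =
     (if m \<in> {2..j} \<and> a + 1 = m then Healthy (m - 1)
      else if m \<in> {2..j} \<and> a = m then Ill m
      else Healthy m)"
| "D_step j (Ill m) a = (if m \<in> {2..j} \<and> a + 1 = m then Dead else Ill m)"
| "D_step j Dead a = Dead"

definition accepts :: "(state \<Rightarrow> nat \<Rightarrow> state) \<Rightarrow> state \<Rightarrow> nat list \<Rightarrow> bool" where
  "accepts step q0 w \<longleftrightarrow> (\<forall>t\<le>length w. foldl step q0 (take t w) \<noteq> Dead)"

definition U_accepts :: "nat \<Rightarrow> nat \<Rightarrow> nat list \<Rightarrow> bool" where
  "U_accepts n j w \<longleftrightarrow> accepts (U_step n j) (Healthy j) w"

definition D_accepts :: "nat \<Rightarrow> nat list \<Rightarrow> bool" where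
  "D_accepts j w \<longleftrightarrow> accepts (D_step j) (Healthy j) w"

end

theory Submission
  imports Defs
begin

text \<open>
  Appending the letter \<open>s\<^sub>a\<close> to a word swaps the entries at positions \<open>a\<close> and \<open>a + 1\<close>, and a word is
  reduced iff each such swap creates an inversion. While \<open>U(j)\<close> is in the state \<open>H\<^sub>m\<close> with \<open>m < n\<close>,
  the value \<open>j\<close> sits at position \<open>m\<close> and everything to its right is larger. In the state \<open>I\<^sub>m\<close> all
  entries at positions beyond \<open>m\<close> exceed \<open>j\<close>, and between \<open>j\<close> and position \<open>m\<close> there are only
  smaller ones; so \<open>jki\<close> does not occur. Conversely, if \<open>jki\<close> is avoided but some smaller value
  lies to the right of \<open>j\<close>, then the entry directly after \<open>j\<close> is smaller, and undoing this swap
  repeatedly leads to a permutation with only larger values after \<open>j\<close>, all of whose reduced words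
  end in a healthy state. The statement about \<open>D(j)\<close> follows by conjugation with the longest element.
\<close>

section \<open>Reduced words and inversions\<close>

lemma adj_transp_simps [simp]:
  "adj_transp a a = Suc a" "adj_transp a (Suc a) = a"
  "x \<noteq> a \<Longrightarrow> x \<noteq> Suc a \<Longrightarrow> adj_transp a x = x"
  by (auto simp: adj_transp_def)

lemma adj_transp_if: "adj_transp a x = (if x = a then Suc a else if x = Suc a then a else x)"
  by auto

lemma adj_transp_invol [simp]: "adj_transp a (adj_transp a x) = x"
  by (simp add: adj_transp_def)

lemma comp_adj_transp_invol [simp]: "f \<circ> adj_transp a \<circ> adj_transp a = f"
  by (simp add: fun_eq_iff)

lemma adj_transp_permutes: "a \<in> {1..n - 1} \<Longrightarrow> adj_transp a permutes {1..n}"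
  unfolding adj_transp_def by (rule permutes_swap_id) auto

lemma word_perm_Nil [simp]: "word_perm [] = id"
  by (simp add: word_perm_def)

lemma word_perm_Cons [simp]: "word_perm (a # w) = adj_transp a \<circ> word_perm w"
  by (simp add: word_perm_def)

lemma word_perm_snoc [simp]: "word_perm (w @ [a]) = word_perm w \<circ> adj_transp a"
  by (induction w) (auto simp: fun_eq_iff)

lemma word_perm_permutes: "w \<in> lists {1..n - 1} \<Longrightarrow> word_perm w permutes {1..n}"
proof (induction w)
  case Nil
  show ?case unfolding word_perm_Nil by (rule permutes_id)
next
  case (Cons a w)
  then have "word_perm w permutes {1..n}" "a \<in> {1..n - 1}" by auto
  then show ?case
    unfolding word_perm_Cons by (intro permutes_compose adj_transp_permutes)
qed

section \<open>Inversion number and word length\<close>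

definition inversions :: "nat \<Rightarrow> (nat \<Rightarrow> nat) \<Rightarrow> (nat \<times> nat) set" where
  "inversions n f = {(p, q). 1 \<le> p \<and> p < q \<and> q \<le> n \<and> f q < f p}"

lemma finite_inversions [simp]: "finite (inversions n f)"
  by (rule finite_subset[of _ "{1..n} \<times> {1..n}"]) (auto simp: inversions_def)

lemma inversions_ident [simp]: "inversions n (\<lambda>x. x) = {}"
  by (auto simp: inversions_def)

text \<open>The transposition, applied to both positions of a pair, maps the inversions of
  \<open>f\<close> bijectively onto those of \<open>f \<circ> adj_transp a\<close> other than
  \<open>(a, Suc a)\<close>, the one new inversion.\<close>

lemma card_inversions_ascent:
  assumes a: "a \<in> {1..n - 1}" and asc: "f a < f (Suc a)"
  shows "card (inversions n (f \<circ> adj_transp a)) = Suc (card (inversions n f))"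
proof -
  let ?s = "adj_transp a" and ?S = "map_prod (adj_transp a) (adj_transp a)"
  have inv: "?S (?S x) = x" for x by (cases x) simp
  have "inversions n (f \<circ> ?s) = insert (a, Suc a) (?S ` inversions n f)"
  proof (intro set_eqI iffI)
    fix x assume x: "x \<in> inversions n (f \<circ> ?s)"
    show "x \<in> insert (a, Suc a) (?S ` inversions n f)"
    proof (cases "x = (a, Suc a)")
      case False
      with x a have "?S x \<in> inversions n f"
        by (cases x) (auto simp: inversions_def adj_transp_if split: if_splits)
      then show ?thesis using inv[of x] by (metis image_eqI insertI2)
    qed simp
  next
    fix x assume "x \<in> insert (a, Suc a) (?S ` inversions n f)"
    then show "x \<in> inversions n (f \<circ> ?s)"
      using a asc by (auto simp: inversions_def adj_transp_if split: if_splits)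
  qed
  moreover have "(a, Suc a) \<notin> ?S ` inversions n f"
  proof
    assume "(a, Suc a) \<in> ?S ` inversions n f"
    then have "?S (a, Suc a) \<in> inversions n f" using inv by (metis (mono_tags) imageE)
    then show False by (auto simp: inversions_def)
  qed
  moreover have "inj_on ?S (inversions n f)" by (metis inv inj_onI)
  ultimately show ?thesis by (simp add: card_image)
qed

lemma card_inversions_descent:
  assumes "a \<in> {1..n - 1}" and "f (Suc a) < f a"
  shows "card (inversions n f) = Suc (card (inversions n (f \<circ> adj_transp a)))"
  using card_inversions_ascent[of a n "f \<circ> adj_transp a"] assms by simp

text \<open>Each letter changes the inversion number by exactly one, and the identity has
  none.\<close>

lemma card_inversions_le_length:
  "w \<in> lists {1..n - 1} \<Longrightarrow> card (inversions n (word_perm w)) \<le> length w"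
proof (induction w rule: rev_induct)
  case Nil
  then show ?case by simp
next
  case (snoc a w)
  then have IH: "card (inversions n (word_perm w)) \<le> length w" and a: "a \<in> {1..n - 1}"
    and "word_perm w permutes {1..n}"
    using word_perm_permutes[of w n] by auto
  then have "word_perm w a \<noteq> word_perm w (Suc a)"
    using permutes_inj by (metis injD n_not_Suc_n)
  then show ?case
    using card_inversions_ascent[OF a, of "word_perm w"]
      card_inversions_descent[OF a, of "word_perm w"] IH
    by (simp only: word_perm_snoc length_append_singleton) linarith
qed

text \<open>Undoing a descent lowers the inversion number by one, so sorting \<pi> by such swaps
  takes exactly that many letters.\<close>

lemma ex_word_length_inversions:
  assumes "\<pi> permutes {1..n}"
  shows "\<exists>w. word_for n w \<pi> \<and> length w = card (inversions n \<pi>)"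
  using assms
proof (induction "card (inversions n \<pi>)" arbitrary: \<pi>)
  case 0
  have asc: "\<pi> a < \<pi> (Suc a)" if a: "a \<in> {1..n - 1}" for a
  proof (rule ccontr)
    assume "\<not> \<pi> a < \<pi> (Suc a)"
    moreover have "\<pi> a \<noteq> \<pi> (Suc a)" using 0 permutes_inj by (metis injD n_not_Suc_n)
    ultimately show False using 0 card_inversions_descent[OF a, of \<pi>] by simp
  qed
  \<comment> \<open>Without descents the entries increase strictly from a value of at least 1, so
    none lies below its position; this forces the identity.\<close>
  have ge: "p \<in> {1..n} \<longrightarrow> p \<le> \<pi> p" for p
  proof (induction p)
    case (Suc p)
    show ?case
    proof (cases "p = 0")
      case True
      then show ?thesis using permutes_in_image[OF 0(2), of "Suc p"] by auto
    next
      case False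
      then have "\<pi> p < \<pi> (Suc p)" if "Suc p \<le> n" using that by (intro asc) auto
      then show ?thesis using Suc False by auto
    qed
  qed simp
  have "\<pi> = id" by (rule permutes_natset_ge[OF 0(2)]) (use ge in auto)
  then show ?case using 0 by (intro exI[of _ "[]"]) (auto simp: word_for_def)
next
  case (Suc k)
  have "\<exists>a\<in>{1..n - 1}. \<pi> (Suc a) < \<pi> a"
  proof (rule ccontr)
    assume "\<not> ?thesis"
    then have no: "\<pi> a \<le> \<pi> (Suc a)" if "1 \<le> a" "Suc a \<le> n" for a using that by force
    have mono: "\<pi> p \<le> \<pi> q" if "p \<le> q" "1 \<le> p" "q \<le> n" for p q
      using that
    proof (induction q rule: dec_induct)
      case (step q)
      then show ?case using no[of q] by simp
    qed simp
    have "\<not> \<pi> q < \<pi> p" if "1 \<le> p" "p < q" "q \<le> n" for p q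
      using mono[of p q] that by simp
    then have "inversions n \<pi> = {}" by (auto simp: inversions_def)
    then show False using Suc by simp
  qed
  then obtain a where a: "a \<in> {1..n - 1}" "\<pi> (Suc a) < \<pi> a" by blast
  let ?\<sigma> = "\<pi> \<circ> adj_transp a"
  have "card (inversions n ?\<sigma>) = k" using card_inversions_descent[of a n \<pi>] a Suc by simp
  moreover have "?\<sigma> permutes {1..n}"
    using a Suc by (intro permutes_compose adj_transp_permutes)
  ultimately obtain w where "word_for n w ?\<sigma>" "length w = k" using Suc.hyps(1)[of ?\<sigma>] by auto
  then show ?case using a Suc.hyps(2) by (intro exI[of _ "w @ [a]"]) (auto simp: word_for_def)
qed

text \<open>Minimality is replaced by the inversion count of the word's own product, a condition
  that can be followed letter by letter.\<close>

definition reduced :: "nat \<Rightarrow> nat list \<Rightarrow> bool" where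
  "reduced n w \<longleftrightarrow> w \<in> lists {1..n - 1} \<and> length w = card (inversions n (word_perm w))"

lemma reduced_word_for_iff:
  assumes "\<pi> permutes {1..n}"
  shows "reduced_word_for n w \<pi> \<longleftrightarrow> reduced n w \<and> word_perm w = \<pi>"
proof
  assume "reduced_word_for n w \<pi>"
  then show "reduced n w \<and> word_perm w = \<pi>"
    using ex_word_length_inversions[OF assms] card_inversions_le_length[of w n]
    by (fastforce simp: reduced_word_for_def reduced_def word_for_def)
next
  assume "reduced n w \<and> word_perm w = \<pi>"
  then show "reduced_word_for n w \<pi>"
    using card_inversions_le_length
    by (fastforce simp: reduced_word_for_def reduced_def word_for_def)
qed

lemma reduced_Nil [simp]: "reduced n []"
  by (simp add: reduced_def id_def)

text \<open>At an ascent, length and inversion number both grow by one. A last letter at a descent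
  would give \<open>w\<close> two more inversions than letters.\<close>

lemma reduced_snoc:
  "reduced n (w @ [a]) \<longleftrightarrow>
     reduced n w \<and> a \<in> {1..n - 1} \<and> word_perm w a < word_perm w (Suc a)"
proof (cases "w \<in> lists {1..n - 1} \<and> a \<in> {1..n - 1}")
  case True
  then have a: "a \<in> {1..n - 1}" and "word_perm w permutes {1..n}"
    using word_perm_permutes[of w n] by auto
  then have "word_perm w a \<noteq> word_perm w (Suc a)"
    using permutes_inj by (metis injD n_not_Suc_n)
  then show ?thesis
    using card_inversions_ascent[OF a, of "word_perm w"]
      card_inversions_descent[OF a, of "word_perm w"] True card_inversions_le_length[of w n]
    by (cases "word_perm w a < word_perm w (Suc a)") (auto simp: reduced_def)
qed (auto simp: reduced_def)

section \<open>The automaton \<open>U(j)\<close>\<close>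

text \<open>\<open>Dead\<close> is absorbing, so a run that ever meets it also ends there.\<close>

lemma accepts_iff:
  assumes "\<And>a. step Dead a = Dead"
  shows "accepts step q w \<longleftrightarrow> foldl step q w \<noteq> Dead"
proof -
  have dead: "foldl step Dead v = Dead" for v by (induction v) (auto simp: assms)
  have "foldl step q w = foldl step (foldl step q (take t w)) (drop t w)" for t
    by (metis append_take_drop_id foldl_append)
  then show ?thesis unfolding accepts_def using dead by (metis le_refl take_all_iff)
qed

lemma U_accepts_iff: "U_accepts n j w \<longleftrightarrow> foldl (U_step n j) (Healthy j) w \<noteq> Dead"
  by (simp add: U_accepts_def accepts_iff)

lemma D_accepts_iff: "D_accepts j w \<longleftrightarrow> foldl (D_step j) (Healthy j) w \<noteq> Dead"
  by (simp add: D_accepts_def accepts_iff)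

text \<open>Only position \<open>p\<close> carries \<open>j\<close>, so an entry further right that
  is not above \<open>j\<close> is below it. Avoidance thus means that right of \<open>p\<close> all
  smaller entries precede all larger ones.\<close>

lemma avoids_jki_iff:
  assumes "\<pi> permutes {1..n}" and "1 \<le> p" and "\<pi> p = j"
  shows "avoids_jki n j \<pi> \<longleftrightarrow> (\<forall>q r. p < q \<longrightarrow> q < r \<longrightarrow> r \<le> n \<longrightarrow> j < \<pi> q \<longrightarrow> j < \<pi> r)"
proof -
  have "inj \<pi>" using assms(1) by (rule permutes_inj)
  then have *: "\<pi> x = j \<longleftrightarrow> x = p" for x using assms(3) by (metis injD)
  show ?thesis
  proof (intro iffI allI impI)
    fix q r assume av: "avoids_jki n j \<pi>" and qr: "p < q" "q < r" "r \<le> n" "j < \<pi> q"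
    show "j < \<pi> r"
    proof (rule ccontr)
      assume "\<not> j < \<pi> r"
      then have "\<pi> r < j" using *[of r] qr by auto
      moreover have "appear_in_order n \<pi> j (\<pi> q) (\<pi> r)"
        unfolding appear_in_order_def using qr assms(2,3) by blast
      ultimately show False using av qr(4) unfolding avoids_jki_def by blast
    qed
  next
    assume "\<forall>q r. p < q \<longrightarrow> q < r \<longrightarrow> r \<le> n \<longrightarrow> j < \<pi> q \<longrightarrow> j < \<pi> r"
    then show "avoids_jki n j \<pi>"
      unfolding avoids_jki_def appear_in_order_def using * by (metis less_asym)
  qed
qed

fun U_invariant :: "nat \<Rightarrow> nat \<Rightarrow> nat \<Rightarrow> (nat \<Rightarrow> nat) \<Rightarrow> state \<Rightarrow> bool" where
  "U_invariant n j p \<pi> (Healthy m) \<longleftrightarrow>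
     m \<in> {j..n} \<and> (m = p \<and> (\<forall>q. p < q \<longrightarrow> q \<le> n \<longrightarrow> j < \<pi> q) \<or>
       m = n \<and> (\<forall>q. p < q \<longrightarrow> q \<le> n \<longrightarrow> \<pi> q < j))"
| "U_invariant n j p \<pi> (Ill m) \<longleftrightarrow>
     m \<in> {j..n - 1} \<and> (\<forall>q. m < q \<longrightarrow> q \<le> n \<longrightarrow> j < \<pi> q) \<and>
     (\<forall>q. p < q \<longrightarrow> q \<le> m \<longrightarrow> \<pi> q < j)"
| "U_invariant n j p \<pi> Dead \<longleftrightarrow> True"

text \<open>At an ascent, \<open>j\<close> moves right only past larger entries and left only past
  smaller ones. A swap not involving \<open>j\<close> can mix the two blocks of \<open>Ill m\<close>
  only if \<open>a = m\<close>, and that letter leads to \<open>Dead\<close>.\<close>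

lemma U_invariant_step:
  assumes inv: "U_invariant n j p \<pi> s" and p: "\<pi> p = j" "p \<in> {1..n}" and j: "1 \<le> j"
    and a: "a \<in> {1..n - 1}" and asc: "\<pi> a < \<pi> (Suc a)"
  shows "U_invariant n j (adj_transp a p) (\<pi> \<circ> adj_transp a) (U_step n j s a)"
proof -
  consider "a = p" | "Suc a = p" | "a \<noteq> p" "Suc a \<noteq> p" by blast
  then show ?thesis
  proof cases
    case 1
    then show ?thesis using assms
      by (cases s) (auto simp: adj_transp_if split: if_splits)
  next
    case 2
    then show ?thesis using assms
      by (cases s) (auto simp: adj_transp_if split: if_splits)
  next
    case 3
    then show ?thesis using assms
      by (cases s) (auto simp: adj_transp_if split: if_splits)
  qed
qed

lemma U_invariant_foldl:
  assumes "1 \<le> j" "j \<le> n" and "reduced n w"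
  shows "\<exists>p\<in>{1..n}. word_perm w p = j \<and>
    U_invariant n j p (word_perm w) (foldl (U_step n j) (Healthy j) w)"
  using assms(3)
proof (induction w rule: rev_induct)
  case Nil
  then show ?case using assms(1,2) by (intro bexI[of _ j]) auto
next
  case (snoc a w)
  from snoc.prems have w: "reduced n w" and a: "a \<in> {1..n - 1}"
    and asc: "word_perm w a < word_perm w (Suc a)"
    by (auto simp: reduced_snoc)
  from snoc.IH[OF w] obtain p where p: "p \<in> {1..n}" "word_perm w p = j"
    "U_invariant n j p (word_perm w) (foldl (U_step n j) (Healthy j) w)" by blast
  have "adj_transp a p \<in> {1..n}"
    using p(1) a by (auto simp: adj_transp_if)
  then show ?case using U_invariant_step[OF p(3,2,1) assms(1) a asc] p(2)
    by (intro bexI[of _ "adj_transp a p"] conjI)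
      (simp_all add: comp_def)
qed

lemma avoids_jki_if_U_accepts:
  assumes "1 \<le> j" "j \<le> n" "reduced n w" "U_accepts n j w"
  shows "avoids_jki n j (word_perm w)"
proof -
  obtain p where p: "p \<in> {1..n}" "word_perm w p = j"
    "U_invariant n j p (word_perm w) (foldl (U_step n j) (Healthy j) w)"
    using U_invariant_foldl[OF assms(1-3)] by blast
  have "word_perm w permutes {1..n}"
    using assms(3) word_perm_permutes unfolding reduced_def by blast
  moreover have "j < word_perm w r"
    if qr: "p < q" "q < r" "r \<le> n" "j < word_perm w q" for q r
  proof (cases "foldl (U_step n j) (Healthy j) w")
    case (Healthy m)
    have "q \<le> n" using qr by simp
    then have "\<not> word_perm w q < j" using qr by simp
    then show ?thesis using p(3) qr \<open>q \<le> n\<close> unfolding Healthy by (auto dest: less_trans)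
  next
    case (Ill m)
    \<comment> \<open>Between \<open>p\<close> and the border \<open>m\<close> all entries are
      smaller than \<open>j\<close>, so the larger entry at \<open>q\<close> lies beyond
      \<open>m\<close>, and so does \<open>r\<close>.\<close>
    have "m < q" using p(3) qr unfolding Ill by (auto simp: not_less[symmetric] dest: less_asym)
    then show ?thesis using p(3) qr unfolding Ill by auto
  next
    case Dead
    then show ?thesis using assms(4) by (simp add: U_accepts_iff)
  qed
  ultimately show ?thesis using p by (subst avoids_jki_iff[of _ _ p]) auto
qed

text \<open>Removing the last letter keeps all entries right of \<open>j\<close> larger: a last
  letter moving \<open>j\<close> left would leave a smaller entry just after it. Hence
  \<open>j\<close> only ever moves right, and the healthy index follows its position.\<close>

lemma U_state_healthy:
  assumes "1 \<le> j" "reduced n w" "p \<in> {1..n}" "word_perm w p = j"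
    and "\<And>q. p < q \<Longrightarrow> q \<le> n \<Longrightarrow> j < word_perm w q"
  shows "foldl (U_step n j) (Healthy j) w = Healthy p \<and> j \<le> p"
  using assms(2-)
proof (induction w arbitrary: p rule: rev_induct)
  case (snoc a w)
  let ?\<pi> = "word_perm w"
  from snoc.prems have w: "reduced n w" and a: "a \<in> {1..n - 1}" and asc: "?\<pi> a < ?\<pi> (Suc a)"
    by (auto simp: reduced_snoc)
  have p: "p \<in> {1..n}" "?\<pi> (adj_transp a p) = j" using snoc.prems by auto
  have gt: "j < ?\<pi> (adj_transp a q)" if "p < q" "q \<le> n" for q
    using snoc.prems(4)[of q] that by simp
  consider "a = p" | "Suc a = p" | "a \<noteq> p" "Suc a \<noteq> p" by blast
  then show ?case
  proof cases
    case 1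
    then show ?thesis using gt[of "Suc a"] p a asc by force
  next
    case 2
    \<comment> \<open>Position \<open>p\<close> held the entry that \<open>j\<close> then jumped
      over; by \<open>asc\<close> it is larger.\<close>
    have "j < ?\<pi> q" if "a < q" "q \<le> n" for q
      using gt[of q] that 2 asc p by (cases "q = p") auto
    then have "foldl (U_step n j) (Healthy j) w = Healthy a \<and> j \<le> a"
      using snoc.IH[OF w, of a] a p 2 by auto
    then show ?thesis using 2 a by auto
  next
    case 3
    have "j < ?\<pi> q" if "p < q" "q \<le> n" for q
    proof -
      have "p < adj_transp a q" "adj_transp a q \<le> n"
        using that 3 a by (auto simp: adj_transp_if)
      then show ?thesis using gt[of "adj_transp a q"] by simp
    qed
    then have "foldl (U_step n j) (Healthy j) w = Healthy p \<and> j \<le> p"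
      using snoc.IH[OF w, of p] p 3 by auto
    then show ?thesis using 3 by auto
  qed
qed auto

text \<open>Induction moves \<open>j\<close> to the right by undoing swaps with a smaller right
  neighbour. The final state is recorded precisely enough to ensure that appending the letter
  \<open>p\<close> again does not kill the run.\<close>

lemma ex_U_accepted_word:
  assumes "1 \<le> j" "\<pi> permutes {1..n}" "p \<in> {1..n}" "\<pi> p = j" "avoids_jki n j \<pi>"
  shows "\<exists>w. reduced n w \<and> word_perm w = \<pi> \<and>
    (foldl (U_step n j) (Healthy j) w = Healthy p \<and> j \<le> p \<or>
     foldl (U_step n j) (Healthy j) w \<in> insert (Healthy n) (Ill ` {p<..}))"
  using assms(2-)
proof (induction "n - p" arbitrary: p \<pi> rule: less_induct)
  case (less p \<pi>)
  let ?run = "foldl (U_step n j) (Healthy j)"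
  show ?case
  proof (cases "\<forall>q. p < q \<longrightarrow> q \<le> n \<longrightarrow> j < \<pi> q")
    case True
    obtain w where w: "reduced n w" "word_perm w = \<pi>"
      using ex_word_length_inversions[OF less.prems(1)] by (auto simp: reduced_def word_for_def)
    then show ?thesis using U_state_healthy[OF assms(1) w(1), of p] less.prems True by auto
  next
    case False
    then obtain r where r: "p < r" "r \<le> n" "\<not> j < \<pi> r" by blast
    \<comment> \<open>A larger entry strictly between \<open>p\<close> and \<open>r\<close> would
      complete the pattern with the smaller entry at \<open>r\<close>.\<close>
    have av: "\<not> j < \<pi> q" if "p < q" "q < r" for q
      using less.prems avoids_jki_iff[of \<pi> n p j] r that by auto
    have desc: "\<pi> (Suc p) < \<pi> p"
    proof -
      have "\<not> j < \<pi> (Suc p)" using av[of "Suc p"] r by (cases "Suc p = r") auto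
      moreover have "\<pi> (Suc p) \<noteq> \<pi> p"
        using permutes_inj[OF less.prems(1)] by (metis injD n_not_Suc_n)
      ultimately show ?thesis using less.prems by simp
    qed
    let ?\<sigma> = "\<pi> \<circ> adj_transp p"
    have a: "p \<in> {1..n - 1}" using r less.prems by auto
    have \<sigma>: "?\<sigma> permutes {1..n}" using a less.prems by (intro permutes_compose adj_transp_permutes)
    have "\<forall>q r. p < q \<longrightarrow> q < r \<longrightarrow> r \<le> n \<longrightarrow> j < \<pi> q \<longrightarrow> j < \<pi> r"
      using less.prems avoids_jki_iff[of \<pi> n p j] by auto
    \<comment> \<open>Beyond \<open>Suc p\<close>, the new position of \<open>j\<close>, the
      permutation is unchanged.\<close>
    then have "\<forall>q r. Suc p < q \<longrightarrow> q < r \<longrightarrow> r \<le> n \<longrightarrow> j < ?\<sigma> q \<longrightarrow> j < ?\<sigma> r"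
      by (simp add: adj_transp_if) (meson Suc_lessD)
    then have "avoids_jki n j ?\<sigma>"
      using less.prems avoids_jki_iff[OF \<sigma>, of "Suc p" j] by simp
    then obtain w where w: "reduced n w" "word_perm w = ?\<sigma>"
      "?run w = Healthy (Suc p) \<and> j \<le> Suc p \<or> ?run w \<in> insert (Healthy n) (Ill ` {Suc p<..})"
    proof -
      have "n - Suc p < n - p" "Suc p \<in> {1..n}" "?\<sigma> (Suc p) = j" using a less.prems by auto
      from less.hyps[OF this(1) \<sigma> this(2,3) \<open>avoids_jki n j ?\<sigma>\<close>] that show ?thesis by blast
    qed
    have "reduced n (w @ [p])" using w desc a by (simp add: reduced_snoc)
    moreover have "word_perm (w @ [p]) = \<pi>" using w by simp
    \<comment> \<open>The letter \<open>p\<close> turns \<open>Healthy (Suc p)\<close> into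
      \<open>Ill (Suc p)\<close>, or loops if \<open>Suc p = n\<close>; in \<open>Ill m\<close> with
      \<open>m > Suc p\<close> it is not the fatal letter \<open>m\<close>.\<close>
    moreover have "?run (w @ [p]) \<in> insert (Healthy n) (Ill ` {p<..})" using w(3) a by auto
    ultimately show ?thesis by blast
  qed
qed

lemma U_automaton_iff:
  assumes "j \<in> {1..n}" and \<pi>: "\<pi> permutes {1..n}"
  shows "(\<exists>w. reduced_word_for n w \<pi> \<and> U_accepts n j w) \<longleftrightarrow> avoids_jki n j \<pi>"
proof
  assume "\<exists>w. reduced_word_for n w \<pi> \<and> U_accepts n j w"
  then show "avoids_jki n j \<pi>"
    using avoids_jki_if_U_accepts[of j n] assms by (auto simp: reduced_word_for_iff)
next
  assume av: "avoids_jki n j \<pi>"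
  have "j \<in> \<pi> ` {1..n}" using assms by (simp add: permutes_image)
  then obtain p where "p \<in> {1..n}" "\<pi> p = j" by blast
  then obtain w where "reduced n w" "word_perm w = \<pi>" "foldl (U_step n j) (Healthy j) w \<noteq> Dead"
    using ex_U_accepted_word[of j \<pi> n p] assms av by auto
  then show "\<exists>w. reduced_word_for n w \<pi> \<and> U_accepts n j w"
    using \<pi> by (auto simp: reduced_word_for_iff U_accepts_iff)
qed

section \<open>Conjugation with the longest element\<close>

text \<open>The longest element of the symmetric group, extended by fixed points so that it permutes
  \<open>{1..n}\<close>.\<close>

definition flip :: "nat \<Rightarrow> nat \<Rightarrow> nat" where
  "flip n x = (if x \<in> {1..n} then n + 1 - x else x)"

lemma flip_invol [simp]: "flip n (flip n x) = x"
  by (auto simp: flip_def)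

lemma flip_mem_iff: "flip n x \<in> {1..n} \<longleftrightarrow> x \<in> {1..n}"
  by (auto simp: flip_def)

lemma flip_less_iff: "x \<in> {1..n} \<Longrightarrow> y \<in> {1..n} \<Longrightarrow> flip n x < flip n y \<longleftrightarrow> y < x"
  by (auto simp: flip_def)

lemma flip_permutes: "flip n permutes {1..n}"
  by (rule bij_imp_permutes) (auto simp: flip_def intro!: bij_betwI[where g = "flip n"])

text \<open>This is conjugation, as \<open>flip n\<close> is its own inverse; it reverses the
  one-line notation and complements its values.\<close>

definition conj_flip :: "nat \<Rightarrow> (nat \<Rightarrow> nat) \<Rightarrow> nat \<Rightarrow> nat" where
  "conj_flip n \<pi> = flip n \<circ> \<pi> \<circ> flip n"

lemma conj_flip_invol [simp]: "conj_flip n (conj_flip n \<pi>) = \<pi>"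
  by (auto simp: conj_flip_def)

lemma conj_flip_permutes: "\<pi> permutes {1..n} \<Longrightarrow> conj_flip n \<pi> permutes {1..n}"
  unfolding conj_flip_def by (intro permutes_compose flip_permutes)

lemma adj_transp_flip:
  assumes "a \<in> {1..n - 1}"
  shows "adj_transp (n - a) = conj_flip n (adj_transp a)"
proof
  fix x
  have flip_a: "flip n a = Suc (n - a)" "flip n (Suc a) = n - a"
    using assms by (auto simp: flip_def)
  consider "x = n - a" | "x = Suc (n - a)" | "x \<noteq> n - a" "x \<noteq> Suc (n - a)" by blast
  then show "adj_transp (n - a) x = conj_flip n (adj_transp a) x"
  proof cases
    case 1
    then have "flip n x = Suc a" using flip_a(2) by (metis flip_invol)
    then show ?thesis using 1 by (simp add: conj_flip_def flip_a)
  next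
    case 2
    then have "flip n x = a" using flip_a(1) by (metis flip_invol)
    then show ?thesis using 2 by (simp add: conj_flip_def flip_a)
  next
    case 3
    then have "flip n x \<noteq> a" "flip n x \<noteq> Suc a" using flip_a by (metis flip_invol)+
    then show ?thesis using 3 by (simp add: conj_flip_def)
  qed
qed

text \<open>Conjugation is multiplicative because adjacent flips cancel.\<close>

lemma word_perm_flip:
  "w \<in> lists {1..n - 1} \<Longrightarrow> word_perm (map (\<lambda>a. n - a) w) = conj_flip n (word_perm w)"
proof (induction w)
  case (Cons a w)
  then have "a \<in> {1..n - 1}" by auto
  from adj_transp_flip[OF this] Cons show ?case by (auto simp: conj_flip_def)
qed (auto simp: conj_flip_def)

lemma word_for_flip:
  assumes "word_for n w \<pi>"
  shows "word_for n (map (\<lambda>a. n - a) w) (conj_flip n \<pi>)"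
proof -
  have "map (\<lambda>a. n - a) w \<in> lists {1..n - 1}"
    using assms by (fastforce simp: word_for_def)
  then show ?thesis using assms word_perm_flip by (auto simp: word_for_def)
qed

text \<open>Flipping letters preserves length, and conjugating twice restores \<pi>, so a shorter
  word for the conjugate would yield a shorter one for \<pi>.\<close>

lemma reduced_word_for_flip:
  assumes "reduced_word_for n w \<pi>"
  shows "reduced_word_for n (map (\<lambda>a. n - a) w) (conj_flip n \<pi>)"
  unfolding reduced_word_for_def
proof (intro conjI allI impI)
  show "word_for n (map (\<lambda>a. n - a) w) (conj_flip n \<pi>)"
    using assms by (auto simp: reduced_word_for_def intro: word_for_flip)
next
  fix v assume "word_for n v (conj_flip n \<pi>)"
  then have "word_for n (map (\<lambda>a. n - a) v) \<pi>" using word_for_flip by fastforce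
  then have "length w \<le> length (map (\<lambda>a. n - a) v)"
    using assms unfolding reduced_word_for_def by blast
  then show "length (map (\<lambda>a. n - a) w) \<le> length v" by simp
qed

section \<open>Reflection of the automata\<close>

fun flip_state :: "nat \<Rightarrow> state \<Rightarrow> state" where
  "flip_state n (Healthy m) = Healthy (n + 1 - m)"
| "flip_state n (Ill m) = Ill (n + 1 - m)"
| "flip_state n Dead = Dead"

text \<open>Rules out truncation in \<open>n + 1 - m\<close>, and is kept by the transitions of
  \<open>D_step\<close>.\<close>

fun index_in :: "nat \<Rightarrow> state \<Rightarrow> bool" where
  "index_in n (Healthy m) \<longleftrightarrow> m \<in> {1..n}"
| "index_in n (Ill m) \<longleftrightarrow> m \<in> {1..n}"
| "index_in n Dead \<longleftrightarrow> True"

text \<open>Reflecting indices by \<open>n + 1 - m\<close> and letters by \<open>n - a\<close>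
  carries the range \<open>{2..j}\<close> to \<open>{n + 1 - j..n - 1}\<close> and exchanges the
  conditions \<open>a = m\<close> and \<open>a + 1 = m\<close>.\<close>

lemma U_step_flip:
  assumes "index_in n s" "j \<in> {1..n}" "a \<in> {1..n - 1}"
  shows "U_step n (n + 1 - j) (flip_state n s) (n - a) = flip_state n (D_step j s a)"
    and "index_in n (D_step j s a)"
proof -
  have range: "n + 1 - m \<in> {n + 1 - j..n - 1} \<longleftrightarrow> m \<in> {2..j}" if "m \<in> {1..n}" for m
    using that assms by auto
  have letters: "n - a = n + 1 - m \<longleftrightarrow> a + 1 = m" "n - a + 1 = n + 1 - m \<longleftrightarrow> a = m"
    if "m \<in> {1..n}" for m
    using that assms by auto
  show "U_step n (n + 1 - j) (flip_state n s) (n - a) = flip_state n (D_step j s a)"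
  proof (cases s)
    case (Healthy m)
    then have m: "m \<in> {1..n}" using assms(1) by simp
    then have "n + 1 - m + 1 = n + 1 - (m - 1)" if "m \<in> {2..j}" using that by auto
    then show ?thesis
      unfolding Healthy U_step.simps D_step.simps flip_state.simps range[OF m] letters[OF m]
      by (simp del: atLeastAtMost_iff)
  next
    case (Ill m)
    then have m: "m \<in> {1..n}" using assms(1) by simp
    show ?thesis
      unfolding Ill U_step.simps D_step.simps flip_state.simps range[OF m] letters[OF m]
      by (simp del: atLeastAtMost_iff)
  qed simp
  show "index_in n (D_step j s a)"
    using assms by (cases s) auto
qed

text \<open>Reflection commutes with every letter, hence with whole runs, and only
  \<open>Dead\<close> is sent to \<open>Dead\<close>.\<close>

lemma D_accepts_iff_U_accepts_flip:
  assumes "j \<in> {1..n}" "w \<in> lists {1..n - 1}"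
  shows "D_accepts j w \<longleftrightarrow> U_accepts n (n + 1 - j) (map (\<lambda>a. n - a) w)"
proof -
  have "foldl (U_step n (n + 1 - j)) (flip_state n s) (map (\<lambda>a. n - a) w) =
      flip_state n (foldl (D_step j) s w)" if "index_in n s" for s
    using assms(2) that
  proof (induction w arbitrary: s)
    case (Cons a w)
    then have "a \<in> {1..n - 1}" "w \<in> lists {1..n - 1}" by auto
    then show ?case
      using Cons.IH U_step_flip[OF \<open>index_in n s\<close> assms(1)] by simp
  qed simp
  from this[of "Healthy j"] assms(1)
  have "foldl (U_step n (n + 1 - j)) (Healthy (n + 1 - j)) (map (\<lambda>a. n - a) w) =
      flip_state n (foldl (D_step j) (Healthy j) w)"
    by simp
  moreover have "flip_state n s = Dead \<longleftrightarrow> s = Dead" for s by (cases s) auto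
  ultimately show ?thesis by (simp add: D_accepts_iff U_accepts_iff)
qed

section \<open>Patterns under reversal and complement\<close>

lemma appear_in_order_flip:
  assumes "appear_in_order n \<pi> x y z"
  shows "appear_in_order n (conj_flip n \<pi>) (flip n z) (flip n y) (flip n x)"
proof -
  obtain p q r where pqr: "1 \<le> p" "p < q" "q < r" "r \<le> n" "\<pi> p = x" "\<pi> q = y" "\<pi> r = z"
    using assms by (auto simp: appear_in_order_def)
  have "1 \<le> flip n r \<and> flip n r < flip n q \<and> flip n q < flip n p \<and> flip n p \<le> n"
    using pqr(1-4) by (auto simp: flip_def)
  then show ?thesis
    unfolding appear_in_order_def conj_flip_def
    using pqr(5-7) by (intro exI[of _ "flip n r"] exI[of _ "flip n q"] exI[of _ "flip n p"]) auto
qed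

lemma appear_in_order_range:
  assumes "\<pi> permutes {1..n}" "appear_in_order n \<pi> x y z"
  shows "x \<in> {1..n}" "y \<in> {1..n}" "z \<in> {1..n}"
  using assms permutes_in_image[OF assms(1)] by (fastforce simp: appear_in_order_def)+

text \<open>Reversing and complementing turns \<open>k, i, j\<close> into
  \<open>flip n j, flip n i, flip n k\<close>, where \<open>flip n i\<close> is now the largest
  value and \<open>flip n k\<close> the smallest.\<close>

lemma avoids_kij_iff_avoids_jki_flip:
  assumes \<pi>: "\<pi> permutes {1..n}" and j: "j \<in> {1..n}"
  shows "avoids_kij n j \<pi> \<longleftrightarrow> avoids_jki n (flip n j) (conj_flip n \<pi>)"
proof
  assume av: "avoids_kij n j \<pi>"
  show "avoids_jki n (flip n j) (conj_flip n \<pi>)"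
    unfolding avoids_jki_def
  proof (intro notI, elim exE conjE)
    fix i k
    assume ik: "i < flip n j" "flip n j < k"
      and app: "appear_in_order n (conj_flip n \<pi>) (flip n j) k i"
    \<comment> \<open>The values must be located in \<open>{1..n}\<close> first, since this is where
      \<open>flip n\<close> reverses the order.\<close>
    have "i \<in> {1..n}" "k \<in> {1..n}"
      using appear_in_order_range[OF conj_flip_permutes[OF \<pi>] app] by auto
    moreover have "flip n j \<in> {1..n}" using j by (simp only: flip_mem_iff)
    ultimately have "flip n k < j" "j < flip n i"
      using ik flip_less_iff[of k n "flip n j"] flip_less_iff[of "flip n j" n i]
      by (simp_all del: atLeastAtMost_iff)
    moreover have "appear_in_order n \<pi> (flip n i) (flip n k) j"
      using appear_in_order_flip[OF app] by simp
    ultimately show False using av unfolding avoids_kij_def by blast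
  qed
next
  assume av: "avoids_jki n (flip n j) (conj_flip n \<pi>)"
  show "avoids_kij n j \<pi>"
    unfolding avoids_kij_def
  proof (intro notI, elim exE conjE)
    fix i k
    assume ik: "i < j" "j < k" and app: "appear_in_order n \<pi> k i j"
    have "i \<in> {1..n}" "k \<in> {1..n}"
      using appear_in_order_range[OF \<pi> app] by auto
    then have "flip n k < flip n j" "flip n j < flip n i"
      using ik j by (simp_all add: flip_less_iff del: atLeastAtMost_iff)
    then show False
      using av appear_in_order_flip[OF app] unfolding avoids_jki_def by blast
  qed
qed

section \<open>Transfer of the equivalence to the second automaton\<close>

lemma D_automaton_iff:
  assumes j: "j \<in> {1..n}" and \<pi>: "\<pi> permutes {1..n}"
  shows "(\<exists>w. reduced_word_for n w \<pi> \<and> D_accepts j w) \<longleftrightarrow> avoids_kij n j \<pi>"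
proof -
  let ?f = "map (\<lambda>a. n - a)" and ?\<sigma> = "conj_flip n \<pi>"
  have flip_j: "flip n j = n + 1 - j" using j by (simp add: flip_def)
  have "(\<exists>w. reduced_word_for n w \<pi> \<and> D_accepts j w) \<longleftrightarrow>
      (\<exists>w. reduced_word_for n w ?\<sigma> \<and> U_accepts n (flip n j) w)" (is "?D \<longleftrightarrow> ?U")
  proof
    assume ?D
    then obtain w where w: "reduced_word_for n w \<pi>" "D_accepts j w" by blast
    then have "w \<in> lists {1..n - 1}" by (simp add: reduced_word_for_def word_for_def)
    with w show ?U
      using reduced_word_for_flip D_accepts_iff_U_accepts_flip[OF j] flip_j by metis
  next
    assume ?U
    then obtain w where w: "reduced_word_for n w ?\<sigma>" "U_accepts n (flip n j) w" by blast
    then have "reduced_word_for n (?f w) \<pi>" using reduced_word_for_flip[OF w(1)] by simp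
    moreover from this have "?f w \<in> lists {1..n - 1}"
      unfolding reduced_word_for_def word_for_def by blast
    \<comment> \<open>Letters are at most \<open>n - 1\<close>, so \<open>n - (n - a) = a\<close>
      without truncation.\<close>
    moreover have "?f (?f w) = w"
    proof -
      have "w \<in> lists {1..n - 1}" using w(1) unfolding reduced_word_for_def word_for_def by blast
      then show ?thesis by (induction w) auto
    qed
    ultimately show ?D using D_accepts_iff_U_accepts_flip[OF j, of "?f w"] w(2) flip_j by auto
  qed
  also have "\<dots> \<longleftrightarrow> avoids_jki n (flip n j) ?\<sigma>"
    using j \<pi> by (intro U_automaton_iff conj_flip_permutes) (simp_all only: flip_mem_iff)
  also have "\<dots> \<longleftrightarrow> avoids_kij n j \<pi>"
    using avoids_kij_iff_avoids_jki_flip[OF \<pi> j] by simp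
  finally show ?thesis .
qed

theorem theorem4p16:
  fixes n j :: nat and \<pi> :: "nat \<Rightarrow> nat"
  assumes "n \<ge> 3" and "j \<in> {2..n - 1}" and "\<pi> permutes {1..n}"
  shows "((\<exists>w. reduced_word_for n w \<pi> \<and> U_accepts n j w) \<longleftrightarrow> avoids_jki n j \<pi>) \<and>
         ((\<exists>w. reduced_word_for n w \<pi> \<and> D_accepts j w) \<longleftrightarrow> avoids_kij n j \<pi>)"
proof -
  have "j \<in> {1..n}" using assms(2) by auto
  then show ?thesis using U_automaton_iff D_automaton_iff assms(3) by blast
qed

end
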